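(* Let $m,n$ be positive integers and let $k$ be an integer with $0\le k\le \min(m,n)$. Let $\boldsymbol{z}=\{z_1,\dots,z_n\}$ be a set of (symmetric) variables and $\boldsymbol{\alpha}=\{\alpha_1,\alpha_2,\dots\}$ a set of (factorial) variables, all regarded as independent indeterminates. For the partition $\mu=((m-k)^{n-k},0^k)$ (that is, $n-k$ parts equal to $m-k$ followed by $k$ parts equal to $0$), the following identity of rational functions holds: $$ G_{\mu}(\boldsymbol{z}|\boldsymbol{\alpha})=\sum_{S\in\binom{[m]}{k}} \frac{\displaystyle \prod_{i\in S}(1-\alpha_i)^{m-k}\ \prod_{j\in\overline{S}}\ \prod_{i=1}^n (z_i\oplus\alpha_j)} {\displaystyle \prod_{i\in S}\ \prod_{j\in\overline{S}}(\alpha_j-\alpha_i)}, $$ where $\binom{[m]}{k}$ is the set of $k$-element subsets of $[m]=\{1,2,\dots,m\}$ and $\overline{S}=\{1,2,\dots,m\}\setminus S$.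
   Context: Throughout $\beta=-1$, so $z\oplus\alpha:=z+\alpha-z\alpha$. For an integer $j\ge 0$ put $$[z_i|\boldsymbol{\alpha}]^j=(z_i\oplus\alpha_1)(z_i\oplus\alpha_2)\cdots(z_i\oplus\alpha_j)$$ (equal to $1$ for $j=0$). For a partition $\lambda=(\lambda_1\ge\lambda_2\ge\dots\ge\lambda_n\ge 0)$, the ($\beta=-1$) factorial Grothendieck polynomial in $n$ variables is $$ G_\lambda(\boldsymbol{z}|\boldsymbol{\alpha})=\frac{\det\big([z_i|\boldsymbol{\alpha}]^{\lambda_j+n-j}(1-z_i)^{j-1}\big)_{1\le i,j\le n}}{\prod_{1\le i<j\le n}(z_i-z_j)}. $$ Empty products are equal to $1$. *)

theory Defs
  imports
    "HOL-Library.Poly_Mapping"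
    "HOL-Library.Nat_Bijection"
    "HOL-Computational_Algebra.Fraction_Field"
    "Jordan_Normal_Form.Determinant"
begin

text \<open>
  Rational functions in countably many indeterminates with coefficients in an integral
  domain: the fraction field of the polynomial ring, a polynomial being a finitely supported
  map from monomials to coefficients and a monomial a finitely supported map from variable
  indices to exponents.
\<close>

type_synonym 'a ratfun = "((nat \<Rightarrow>\<^sub>0 nat) \<Rightarrow>\<^sub>0 'a) fract"

definition indet :: "nat \<Rightarrow> 'a::idom ratfun" where
  "indet v = Fract (Poly_Mapping.single (Poly_Mapping.single v 1) 1) 1"

text \<open>
  The two families share one index set through the bijection \<^const>\<open>sum_encode\<close> from
  \<^typ>\<open>nat + nat\<close> to \<^typ>\<open>nat\<close>, so that all of them are distinct indeterminates.
\<close>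

definition zvar :: "nat \<Rightarrow> 'a::idom ratfun" where
  "zvar i = indet (sum_encode (Inl i))"

definition avar :: "nat \<Rightarrow> 'a::idom ratfun" where
  "avar j = indet (sum_encode (Inr j))"

definition goplus :: "'b::comm_ring_1 \<Rightarrow> 'b \<Rightarrow> 'b" where
  "goplus x y = x + y - x * y"

definition fpow :: "'b::comm_ring_1 \<Rightarrow> (nat \<Rightarrow> 'b) \<Rightarrow> nat \<Rightarrow> 'b" where
  "fpow x \<alpha> j = (\<Prod>t\<in>{1..j}. goplus x (\<alpha> t))"

text \<open>
  The families \<open>z\<close> and \<open>\<alpha>\<close> are numbered from 1. A partition is the weakly decreasing list of
  its \<open>n\<close> parts, trailing zeros included, so its length is the number of \<open>z\<close>-variables.
  Matrix and list positions start at 0: the entry at \<open>(i, j)\<close> below is the one in row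
  \<open>i + 1\<close> and column \<open>j + 1\<close> of the usual numbering.
\<close>

definition factorial_grothendieck ::
    "nat list \<Rightarrow> (nat \<Rightarrow> 'b::field) \<Rightarrow> (nat \<Rightarrow> 'b) \<Rightarrow> 'b" where
  "factorial_grothendieck lam z \<alpha> =
     (let n = length lam in
        det (mat n n (\<lambda>(i, j).
          fpow (z (i + 1)) \<alpha> (lam ! j + n - (j + 1)) * (1 - z (i + 1)) ^ j))
        / (\<Prod>(i, j) \<in> {(i, j). 1 \<le> i \<and> i < j \<and> j \<le> n}. (z i - z j)))"

end

theory Submission
  imports Defs
begin

text \<open>
  In the coordinates \<open>w\<^sub>i = 1 - z\<^sub>i\<close> and \<open>u\<^sub>t = 1 - \<alpha>\<^sub>t\<close> one has \<open>z\<^sub>i \<oplus> \<alpha>\<^sub>t = 1 - w\<^sub>i u\<^sub>t\<close>,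
  \<open>z\<^sub>i - z\<^sub>j = w\<^sub>j - w\<^sub>i\<close> and \<open>\<alpha>\<^sub>j - \<alpha>\<^sub>i = u\<^sub>i - u\<^sub>j\<close>, so the signs disappear and the denominator of
  the Grothendieck polynomial becomes the Vandermonde product of the \<open>w\<^sub>i\<close>.

  Put \<open>N = n - k\<close> and \<open>P(x) = (1 - u\<^sub>1 x) \<dots> (1 - u\<^sub>m x)\<close>. Counting columns from 0, those with
  \<open>j < N\<close> of the determinant are \<open>P(x) x\<^sup>j\<close>, and those with \<open>N \<le> j < n\<close> are \<open>x\<^sup>j\<close>, each times a
  polynomial with constant term 1 that cannot reach beyond its own block of columns. Unitriangular
  column operations remove these factors, and with them all \<open>\<alpha>\<^sub>t\<close> with \<open>t > m\<close>
  (\<open>det_nested_node_polys\<close>). What remains is the determinant with columns \<open>P(x) x\<^sup>j\<close> for \<open>j < N\<close> and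
  \<open>x\<^sup>j\<close> for \<open>N \<le> j < n\<close>.

  That this determinant is the Vandermonde product times the sum over \<open>k\<close>-subsets is shown by
  induction on \<open>k\<close> (\<open>block_det_eq_subset_sum\<close>). For \<open>k = 0\<close> every column carries the factor \<open>P\<close>. For
  \<open>k > 0\<close> both sides are polynomials of degree less than \<open>m + n - 1\<close> in the last variable
  \<open>x = w\<^sub>n\<close>, so \<open>m + n - 1\<close> points of agreement are enough. Both sides vanish at the other \<open>n - 1\<close>
  variables. At \<open>x = 1/u\<^sub>t\<close> only the subsets that contain \<open>t\<close> contribute to the sum, and the
  determinant has only zeros in the first \<open>N\<close> places of its last row; each side becomes the same
  product times the corresponding expression with the last variable and \<open>u\<^sub>t\<close> removed and \<open>k\<close>
  lowered by 1 (\<open>subset_sum_last_at_root\<close>, \<open>block_det_last_at_root\<close>), where the induction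
  hypothesis applies. The distinctness and non-vanishing conditions of this argument hold
  for independent indeterminates.
\<close>

section \<open>Determinants with two blocks of columns\<close>

lemma det_scale_rows:
  fixes c :: "nat \<Rightarrow> 'b::idom"
  shows "det (mat n n (\<lambda>(i, j). c i * a i j)) = (\<Prod>i<n. c i) * det (mat n n (\<lambda>(i, j). a i j))"
proof -
  have "det (mat\<^sub>r n n (\<lambda>i. c i \<cdot>\<^sub>v vec n (a i))) = prod c {0..<n} * det (mat\<^sub>r n n (\<lambda>i. vec n (a i)))"
    by (rule det_rows_mul) auto
  moreover have "mat\<^sub>r n n (\<lambda>i. c i \<cdot>\<^sub>v vec n (a i)) = mat n n (\<lambda>(i, j). c i * a i j)"
    by (rule eq_matI) auto
  moreover have "mat\<^sub>r n n (\<lambda>i. vec n (a i)) = mat n n (\<lambda>(i, j). a i j)"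
    by (rule eq_matI) auto
  ultimately show ?thesis by (simp add: lessThan_atLeast0)
qed

text \<open>
  Column \<open>j\<close> of \<open>f\<close> is column \<open>j\<close> of \<open>g\<close> plus a combination of later ones: the two matrices
  differ by a lower unitriangular factor on the right.
\<close>
lemma det_unitriangular_columns:
  fixes f g c :: "nat \<Rightarrow> nat \<Rightarrow> 'b::idom"
  assumes f: "\<And>i j. i < n \<Longrightarrow> j < n \<Longrightarrow> f i j = (\<Sum>l\<in>{j..<n}. g i l * c l j)"
    and c: "\<And>j. j < n \<Longrightarrow> c j j = 1"
  shows "det (mat n n (\<lambda>(i, j). f i j)) = det (mat n n (\<lambda>(i, j). g i j))"
proof -
  define C where "C = mat n n (\<lambda>(l, j). if j \<le> l then c l j else 0)"
  have "mat n n (\<lambda>(i, j). f i j) = mat n n (\<lambda>(i, j). g i j) * C"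
  proof (rule eq_matI)
    fix i j assume "i < dim_row (mat n n (\<lambda>(i, j). g i j) * C)" "j < dim_col (mat n n (\<lambda>(i, j). g i j) * C)"
    then have ij: "i < n" "j < n" by (auto simp: C_def)
    have "(mat n n (\<lambda>(i, j). g i j) * C) $$ (i, j)
        = (\<Sum>l\<in>{0..<n}. g i l * (if j \<le> l then c l j else 0))"
      using ij by (auto simp: C_def scalar_prod_def intro!: sum.cong)
    also have "\<dots> = (\<Sum>l\<in>{j..<n}. g i l * c l j)"
      by (rule sum.mono_neutral_cong_right) auto
    finally show "mat n n (\<lambda>(i, j). f i j) $$ (i, j) = (mat n n (\<lambda>(i, j). g i j) * C) $$ (i, j)"
      using ij f by simp
  qed (auto simp: C_def)
  moreover have "det C = 1"
  proof -
    have "det C = prod_list (diag_mat C)"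
      by (rule det_lower_triangular[of n]) (auto simp: C_def)
    also have "\<dots> = 1" unfolding prod_list_diag_prod using c by (simp add: C_def)
    finally show ?thesis .
  qed
  moreover have "det (mat n n (\<lambda>(i, j). g i j) * C) = det (mat n n (\<lambda>(i, j). g i j)) * det C"
    by (rule det_mult[of _ n]) (auto simp: C_def)
  ultimately show ?thesis by simp
qed

definition block_entry :: "nat \<Rightarrow> 'b::idom poly \<Rightarrow> 'b \<Rightarrow> nat \<Rightarrow> 'b" where
  "block_entry N P x j = (if j < N then poly P x else 1) * x ^ j"

text \<open>
  Separating \<open>N\<close> from the size \<open>n\<close> and from \<open>P\<close> lets one variable and one factor of \<open>P\<close> be removed
  while \<open>N\<close> is kept.
\<close>
definition block_det :: "nat \<Rightarrow> nat \<Rightarrow> 'b::idom poly \<Rightarrow> (nat \<Rightarrow> 'b) \<Rightarrow> 'b" where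
  "block_det N n P w = det (mat n n (\<lambda>(i, j). block_entry N P (w i) j))"

lemma block_det_cong:
  assumes "\<And>i. i < n \<Longrightarrow> w i = w' i"
  shows "block_det N n P w = block_det N n P w'"
  unfolding block_det_def by (rule arg_cong[where f = det], rule eq_matI) (use assms in auto)

text \<open>
  If the last variable is a root \<open>1/u\<close> of the polynomial, subtracting \<open>u\<close> times the next column from
  each column \<open>x\<^sup>j\<close> with \<open>N \<le> j < n\<close> turns it into \<open>(1 - u x) x\<^sup>j\<close>. Now every column but the last
  has the factor \<open>1 - u x\<close>, so the last row vanishes up to its last entry, and the remaining rows can be
  divided by that factor. No signs appear, because the surviving entry is on the diagonal.
\<close>
lemma block_det_last_at_root:
  fixes w :: "nat \<Rightarrow> 'b::idom"
  assumes root: "w n * u = 1" and "N \<le> n"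
  shows "block_det N (Suc n) ([:1, - u:] * P) w = (\<Prod>i<n. w n - w i) * block_det N n P w"
proof -
  define Q where "Q = [:1, - u:] * P"
  define g where "g i = block_entry N Q (w i)" for i
  define f where "f i j = (if j < n then (1 - u * w i) * block_entry N P (w i) j else w i ^ n)" for i j
  define c where "c l j = (if l = j then 1 else if l = Suc j \<and> N \<le> j then - u else 0)" for l j
  have Q: "poly Q x = (1 - u * x) * poly P x" for x
    by (simp add: Q_def algebra_simps)
  have fg: "f i j = (\<Sum>l\<in>{j..<Suc n}. g i l * c l j)" if "j < Suc n" for i j
  proof (cases "j < n")
    case True
    have "(\<Sum>l\<in>{j..<Suc n}. g i l * c l j) = (\<Sum>l\<in>{j, Suc j}. g i l * c l j)"
      by (rule sum.mono_neutral_right) (use True in \<open>auto simp: c_def\<close>)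
    also have "\<dots> = f i j"
      using True by (auto simp: c_def f_def g_def block_entry_def Q algebra_simps)
    finally show ?thesis by simp
  next
    case False
    then have "j = n" using that by simp
    then show ?thesis using \<open>N \<le> n\<close> by (simp add: c_def f_def g_def block_entry_def)
  qed
  define F where "F = mat (Suc n) (Suc n) (\<lambda>(i, j). f i j)"
  have "block_det N (Suc n) Q w = det F"
    unfolding block_det_def F_def g_def[symmetric]
    by (rule det_unitriangular_columns[symmetric, where c = c]) (auto simp: fg c_def)
  also have "det F = (\<Sum>j<Suc n. F $$ (n, j) * cofactor F n j)"
    by (rule laplace_expansion_row) (auto simp: F_def)
  also have "\<dots> = w n ^ n * det (mat_delete F n n)"
    using root by (simp add: F_def f_def cofactor_def mult.commute[of u])
  also have "mat_delete F n n = mat n n (\<lambda>(i, j). (1 - u * w i) * block_entry N P (w i) j)"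
    by (rule eq_matI) (auto simp: mat_delete_def F_def f_def)
  also have "det \<dots> = (\<Prod>i<n. 1 - u * w i) * block_det N n P w"
    unfolding block_det_def by (rule det_scale_rows)
  also have "w n ^ n * \<dots> = (\<Prod>i<n. w n * (1 - u * w i)) * block_det N n P w"
    by (simp add: prod.distrib)
  also have "(\<Prod>i<n. w n * (1 - u * w i)) = (\<Prod>i<n. w n - w i)"
  proof (rule prod.cong)
    fix i
    have "w n * (1 - u * w i) = w n - (w n * u) * w i" by (simp add: algebra_simps)
    then show "w n * (1 - u * w i) = w n - w i" by (simp add: root)
  qed simp
  finally show ?thesis by (simp add: Q_def)
qed

definition vandermonde_prod :: "nat \<Rightarrow> (nat \<Rightarrow> 'b::comm_ring_1) \<Rightarrow> 'b" where
  "vandermonde_prod n w = (\<Prod>j<n. \<Prod>i<j. w j - w i)"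

lemma vandermonde_prod_Suc: "vandermonde_prod (Suc n) w = vandermonde_prod n w * (\<Prod>i<n. w n - w i)"
  by (simp add: vandermonde_prod_def)

lemma vandermonde_prod_cong:
  "(\<And>i. i < n \<Longrightarrow> w i = w' i) \<Longrightarrow> vandermonde_prod n w = vandermonde_prod n w'"
  by (auto simp: vandermonde_prod_def intro!: prod.cong)

lemma vandermonde_prod_nonzero:
  fixes w :: "nat \<Rightarrow> 'b::idom"
  assumes "inj_on w {..<n}"
  shows "vandermonde_prod n w \<noteq> 0"
proof -
  have "w j - w i \<noteq> 0" if "j < n" "i < j" for i j
    using inj_onD[OF assms, of j i] that by auto
  then show ?thesis by (simp add: vandermonde_prod_def prod_zero_iff)
qed

text \<open>
  For \<open>N = 0\<close> the polynomial does not occur in the determinant, so it may be chosen to vanish at the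
  last variable; removing the variables one by one in this way is the usual Vandermonde recursion.
\<close>
lemma det_vandermonde:
  fixes w :: "nat \<Rightarrow> 'b::field"
  assumes "\<And>i. i < n \<Longrightarrow> w i \<noteq> 0"
  shows "block_det 0 n P w = vandermonde_prod n w"
  using assms
proof (induction n)
  case 0
  show ?case by (simp add: block_det_def vandermonde_prod_def)
next
  case (Suc n)
  have "block_det 0 (Suc n) P w = block_det 0 (Suc n) ([:1, - inverse (w n):] * P) w"
    by (simp add: block_det_def block_entry_def)
  also have "\<dots> = (\<Prod>i<n. w n - w i) * block_det 0 n P w"
    by (rule block_det_last_at_root) (use Suc.prems in auto)
  finally show ?case using Suc by (simp add: vandermonde_prod_Suc mult.commute)
qed

lemma block_det_full:
  fixes w :: "nat \<Rightarrow> 'b::field"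
  assumes "\<And>i. i < n \<Longrightarrow> w i \<noteq> 0"
  shows "block_det n n P w = (\<Prod>i<n. poly P (w i)) * vandermonde_prod n w"
proof -
  have "block_det n n P w = det (mat n n (\<lambda>(i, j). poly P (w i) * block_entry 0 P (w i) j))"
    unfolding block_det_def by (rule arg_cong[where f = det], rule eq_matI) (auto simp: block_entry_def)
  then show ?thesis
    by (simp only: det_scale_rows block_det_def[symmetric] det_vandermonde[OF assms])
qed

text \<open>Laplace expansion along the last row, whose cofactors do not involve the last variable.\<close>
lemma block_det_last_polynomial:
  fixes w :: "nat \<Rightarrow> 'b::idom"
  assumes "degree P + N \<le> d" "n < d"
  obtains p where "degree p < d" "\<And>x. poly p x = block_det N (Suc n) P (w(n := x))"
proof
  define M where "M x = mat (Suc n) (Suc n) (\<lambda>(i, j). block_entry N P ((w(n := x)) i) j)" for x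
  define q where "q j = (if j < N then P else 1) * monom 1 j" for j
  define p where "p = (\<Sum>j<Suc n. smult (cofactor (M 0) n j) (q j))"
  have "degree (q j) < d" if "j < Suc n" for j
  proof (cases "j < N")
    case True
    have "degree (q j) \<le> degree P + j"
      using degree_mult_le[of P "monom 1 j"] True by (auto simp: q_def degree_monom_eq)
    then show ?thesis using True assms by linarith
  next
    case False
    then show ?thesis using that assms by (auto simp: q_def degree_monom_eq)
  qed
  moreover have "d > 0" using assms by simp
  ultimately show "degree p < d" unfolding p_def
    by (intro degree_sum_less) (auto intro: le_less_trans[OF degree_smult_le])
  fix x
  have cof: "cofactor (M x) n j = cofactor (M 0) n j" for j
  proof -
    have "mat_delete (M x) n j = mat_delete (M 0) n j"
      by (rule eq_matI) (auto simp: mat_delete_def M_def)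
    then show ?thesis by (simp add: cofactor_def)
  qed
  have "block_det N (Suc n) P (w(n := x)) = (\<Sum>j<Suc n. M x $$ (n, j) * cofactor (M x) n j)"
    unfolding block_det_def M_def by (rule laplace_expansion_row) auto
  also have "\<dots> = (\<Sum>j<Suc n. poly (q j) x * cofactor (M 0) n j)"
    unfolding cof by (rule sum.cong) (auto simp: M_def q_def block_entry_def poly_monom)
  finally show "poly p x = block_det N (Suc n) P (w(n := x))"
    by (simp add: p_def poly_sum mult.commute del: sum.lessThan_Suc)
qed

lemma block_det_equal_nodes:
  assumes "a < n" "b < n" "a \<noteq> b" "w a = w b"
  shows "block_det N n P w = 0"
  unfolding block_det_def
  by (rule det_identical_rows[OF _ \<open>a \<noteq> b\<close> \<open>a < n\<close> \<open>b < n\<close>]) (use assms in \<open>auto intro!: eq_vecI\<close>)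

section \<open>The sum over subsets\<close>

definition node_poly :: "('i \<Rightarrow> 'b::idom) \<Rightarrow> 'i set \<Rightarrow> 'b poly" where
  "node_poly u I = (\<Prod>t\<in>I. [:1, - u t:])"

lemma poly_node_poly: "poly (node_poly u I) x = (\<Prod>t\<in>I. 1 - x * u t)"
  by (simp add: node_poly_def poly_prod)

lemma degree_node_poly:
  assumes "finite I"
  shows "degree (node_poly u I) \<le> card I"
proof -
  have "degree (node_poly u I) \<le> sum (degree \<circ> (\<lambda>t. [:1, - u t:])) I"
    unfolding node_poly_def by (rule degree_prod_sum_le[OF assms])
  also have "\<dots> \<le> (\<Sum>t\<in>I. 1)"
    by (rule sum_mono) simp
  finally show ?thesis by simp
qed

text \<open>
  The right-hand side of the identity in the coordinates \<open>w\<close> and \<open>u\<close>. The induction removes an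
  arbitrary element of the index set, which is therefore not an initial segment.
\<close>
definition subset_sum :: "('i \<Rightarrow> 'b::field) \<Rightarrow> 'i set \<Rightarrow> nat \<Rightarrow> nat \<Rightarrow> (nat \<Rightarrow> 'b) \<Rightarrow> 'b" where
  "subset_sum u I k n w = (\<Sum>S\<in>{S. S \<subseteq> I \<and> card S = k}.
     (\<Prod>s\<in>S. u s ^ (card I - k)) * (\<Prod>t\<in>I - S. \<Prod>i<n. 1 - w i * u t)
       / (\<Prod>s\<in>S. \<Prod>t\<in>I - S. u s - u t))"

text \<open>
  If \<open>w\<^sub>n = 1/u\<^sub>t\<close>, a subset avoiding \<open>t\<close> contributes a factor \<open>1 - w\<^sub>n u\<^sub>t = 0\<close>. For a subset
  containing \<open>t\<close> the numerator factors that belong to \<open>u\<^sub>t\<close> and \<open>w\<^sub>n\<close> multiply to \<open>\<Prod>(u\<^sub>t - u\<^sub>r)\<close>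
  over the complement, since the exponent of \<open>u\<^sub>t\<close> is the size of the complement; this
  cancels the part of the denominator that belongs to \<open>t\<close>.
\<close>
lemma subset_sum_last_at_root:
  assumes "finite I" "inj_on u I" "t \<in> I" and root: "w n * u t = 1"
  shows "subset_sum u I (Suc k) (Suc n) w = subset_sum u (I - {t}) k n w"
proof -
  define e where "e = card I - Suc k"
  define summand where "summand S = (\<Prod>s\<in>S. u s ^ e) * (\<Prod>r\<in>I - S. \<Prod>i<Suc n. 1 - w i * u r)
       / (\<Prod>s\<in>S. \<Prod>r\<in>I - S. u s - u r)" for S
  have e: "card (I - {t}) - k = e" using assms by (simp add: e_def)
  have "subset_sum u I (Suc k) (Suc n) w = (\<Sum>S\<in>{S. S \<subseteq> I \<and> card S = Suc k \<and> t \<in> S}. summand S)"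
    unfolding subset_sum_def e_def[symmetric] summand_def
  proof (rule sum.mono_neutral_cong_right)
    show "finite {S. S \<subseteq> I \<and> card S = Suc k}"
      by (rule finite_subset[of _ "Pow I"]) (use assms in auto)
    show "\<forall>S\<in>{S. S \<subseteq> I \<and> card S = Suc k} - {S. S \<subseteq> I \<and> card S = Suc k \<and> t \<in> S}.
       (\<Prod>s\<in>S. u s ^ e) * (\<Prod>r\<in>I - S. \<Prod>i<Suc n. 1 - w i * u r) / (\<Prod>s\<in>S. \<Prod>r\<in>I - S. u s - u r) = 0"
    proof
      fix S assume "S \<in> {S. S \<subseteq> I \<and> card S = Suc k} - {S. S \<subseteq> I \<and> card S = Suc k \<and> t \<in> S}"
      then have "t \<in> I - S" using assms by auto
      then have "(\<Prod>r\<in>I - S. \<Prod>i<Suc n. 1 - w i * u r) = 0"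
        using root \<open>finite I\<close> by (auto simp: prod_zero_iff intro!: bexI[of _ t])
      then show "(\<Prod>s\<in>S. u s ^ e) * (\<Prod>r\<in>I - S. \<Prod>i<Suc n. 1 - w i * u r) / (\<Prod>s\<in>S. \<Prod>r\<in>I - S. u s - u r) = 0"
        by simp
    qed
  qed auto
  also have "\<dots> = subset_sum u (I - {t}) k n w"
    unfolding subset_sum_def e
  proof (rule sum.reindex_bij_witness[where i = "insert t" and j = "\<lambda>S. S - {t}"])
    fix S assume "S \<in> {S. S \<subseteq> I \<and> card S = Suc k \<and> t \<in> S}"
    then have S: "S \<subseteq> I" "card S = Suc k" "t \<in> S" by auto
    then show "insert t (S - {t}) = S" "S - {t} \<in> {S. S \<subseteq> I - {t} \<and> card S = k}" by auto
    define S' T where "S' = S - {t}" and "T = I - S"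
    have fin: "finite S'" "finite T" and "t \<notin> S'" "t \<notin> T"
      using S finite_subset[OF S(1)] assms by (auto simp: S'_def T_def)
    have S_eq: "S = insert t S'" and T_eq: "I - {t} - S' = T"
      using S by (auto simp: S'_def T_def)
    have "card T = e"
      using S \<open>finite I\<close> finite_subset[OF S(1)] by (simp add: T_def e_def card_Diff_subset)
    have nz: "(\<Prod>r\<in>T. u t - u r) \<noteq> 0"
      using fin \<open>t \<notin> T\<close> \<open>t \<in> I\<close> \<open>inj_on u I\<close> by (auto simp: T_def dest: inj_onD)
    have "(\<Prod>r\<in>T. u t - u r) = (\<Prod>r\<in>T. u t * (1 - w n * u r))"
    proof (rule prod.cong)
      fix r
      have "u t * (1 - w n * u r) = u t - (w n * u t) * u r" by (simp add: algebra_simps)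
      then show "u t - u r = u t * (1 - w n * u r)" by (simp add: root)
    qed simp
    also have "\<dots> = u t ^ e * (\<Prod>r\<in>T. 1 - w n * u r)"
      using \<open>card T = e\<close> by (simp add: prod.distrib)
    finally have key: "u t ^ e * (\<Prod>r\<in>T. 1 - w n * u r) = (\<Prod>r\<in>T. u t - u r)" ..
    have "summand S = (\<Prod>s\<in>insert t S'. u s ^ e) * (\<Prod>r\<in>T. \<Prod>i<Suc n. 1 - w i * u r)
        / (\<Prod>s\<in>insert t S'. \<Prod>r\<in>T. u s - u r)"
      unfolding summand_def T_def by (simp only: S_eq)
    also have "\<dots> = (u t ^ e * (\<Prod>r\<in>T. 1 - w n * u r)) * ((\<Prod>s\<in>S'. u s ^ e) * (\<Prod>r\<in>T. \<Prod>i<n. 1 - w i * u r))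
        / ((\<Prod>r\<in>T. u t - u r) * (\<Prod>s\<in>S'. \<Prod>r\<in>T. u s - u r))"
      using fin \<open>t \<notin> S'\<close>
      by (simp add: prod.distrib mult_ac)
    also have "\<dots> = (\<Prod>s\<in>S'. u s ^ e) * (\<Prod>r\<in>T. \<Prod>i<n. 1 - w i * u r) / (\<Prod>s\<in>S'. \<Prod>r\<in>T. u s - u r)"
      unfolding key using nz by simp
    finally show "(\<Prod>s\<in>S - {t}. u s ^ e) * (\<Prod>r\<in>I - {t} - (S - {t}). \<Prod>i<n. 1 - w i * u r)
        / (\<Prod>s\<in>S - {t}. \<Prod>r\<in>I - {t} - (S - {t}). u s - u r) = summand S"
      unfolding S'_def[symmetric] T_eq ..
  next
    fix S assume "S \<in> {S. S \<subseteq> I - {t} \<and> card S = k}"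
    then have S: "S \<subseteq> I - {t}" "card S = k" by auto
    moreover have "finite S" using S(1) \<open>finite I\<close> by (auto intro: finite_subset)
    moreover have "t \<notin> S" using S(1) by auto
    ultimately show "insert t S - {t} = S" "insert t S \<in> {S. S \<subseteq> I \<and> card S = Suc k \<and> t \<in> S}"
      using \<open>t \<in> I\<close> by auto
  qed
  finally show ?thesis .
qed

lemma subset_sum_cong:
  "(\<And>i. i < n \<Longrightarrow> w i = w' i) \<Longrightarrow> subset_sum u I k n w = subset_sum u I k n w'"
  by (auto simp: subset_sum_def intro!: sum.cong)

text \<open>
  The last variable enters the Vandermonde product through \<open>n\<close> linear factors and each summand through
  one linear factor for every element of the complement.
\<close>
lemma subset_sum_last_polynomial:
  assumes "finite I" "k \<le> card I"
  obtains p where "degree p \<le> card I - k + n"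
    "\<And>x. poly p x = vandermonde_prod (Suc n) (w(n := x)) * subset_sum u I k (Suc n) (w(n := x))"
proof
  define C where "C S = (\<Prod>s\<in>S. u s ^ (card I - k)) * (\<Prod>t\<in>I - S. \<Prod>i<n. 1 - w i * u t)
       / (\<Prod>s\<in>S. \<Prod>t\<in>I - S. u s - u t)" for S
  define V where "V = smult (vandermonde_prod n w) (\<Prod>i<n. [:- w i, 1:])"
  define p where "p = V * (\<Sum>S\<in>{S. S \<subseteq> I \<and> card S = k}. smult (C S) (node_poly u (I - S)))"
  have "degree V \<le> n"
    unfolding V_def
    using degree_smult_le degree_prod_sum_le[of "{..<n}" "\<lambda>i. [:- w i, 1:]"] by (simp add: le_trans)
  moreover have "degree (\<Sum>S\<in>{S. S \<subseteq> I \<and> card S = k}. smult (C S) (node_poly u (I - S))) \<le> card I - k"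
  proof (rule degree_sum_le)
    show "finite {S. S \<subseteq> I \<and> card S = k}"
      by (rule finite_subset[of _ "Pow I"]) (use assms in auto)
    fix S assume "S \<in> {S. S \<subseteq> I \<and> card S = k}"
    then have "card (I - S) = card I - k"
      using assms by (auto simp: card_Diff_subset finite_subset)
    then show "degree (smult (C S) (node_poly u (I - S))) \<le> card I - k"
      using degree_smult_le degree_node_poly[of "I - S" u] assms by (metis finite_Diff le_trans)
  qed
  ultimately show "degree p \<le> card I - k + n"
    unfolding p_def using degree_mult_le[of V] by (metis (no_types, lifting) add.commute add_mono le_trans)
  fix x
  have V: "vandermonde_prod (Suc n) (w(n := x)) = poly V x"
    using vandermonde_prod_cong[of n "w(n := x)" w]
    by (simp add: V_def vandermonde_prod_Suc poly_prod)
  have "subset_sum u I k (Suc n) (w(n := x)) = (\<Sum>S\<in>{S. S \<subseteq> I \<and> card S = k}. C S * poly (node_poly u (I - S)) x)"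
    unfolding subset_sum_def by (rule sum.cong) (auto simp: C_def poly_node_poly prod.distrib)
  then show "poly p x = vandermonde_prod (Suc n) (w(n := x)) * subset_sum u I k (Suc n) (w(n := x))"
    by (simp add: p_def V poly_sum)
qed

section \<open>Interpolation in the last variable\<close>

text \<open>
  Induction on \<open>k\<close> with \<open>n - k\<close> and \<open>card I - k\<close> kept constant: evaluating the last variable at \<open>1/u\<^sub>t\<close>
  lowers \<open>n\<close>, \<open>k\<close> and \<open>card I\<close> by one each. The hypothesis \<open>w\<^sub>i u\<^sub>t \<noteq> 1\<close> keeps the two kinds of
  interpolation nodes apart.
\<close>
lemma block_det_eq_subset_sum:
  fixes w :: "nat \<Rightarrow> 'b::field"
  assumes "finite I" "inj_on u I" "\<And>t. t \<in> I \<Longrightarrow> u t \<noteq> 0"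
    and "inj_on w {..<n}" "\<And>i. i < n \<Longrightarrow> w i \<noteq> 0"
    and "\<And>i t. i < n \<Longrightarrow> t \<in> I \<Longrightarrow> w i * u t \<noteq> 1"
    and "k \<le> n" "k \<le> card I"
  shows "block_det (n - k) n (node_poly u I) w = vandermonde_prod n w * subset_sum u I k n w"
  using assms
proof (induction k arbitrary: n I)
  case 0
  have "{S. S \<subseteq> I \<and> card S = 0} = {{}}"
    using 0(1) by (auto dest: finite_subset)
  then have "subset_sum u I 0 n w = (\<Prod>i<n. \<Prod>t\<in>I. 1 - w i * u t)"
    using prod.swap by (simp add: subset_sum_def)
  then show ?case
    using block_det_full[of n w "node_poly u I"] 0 by (simp add: poly_node_poly mult.commute)
next
  case (Suc k n' I)
  then obtain n where n': "n' = Suc n" and "k \<le> n" by (cases n') auto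
  note prems = Suc.prems[unfolded n']
  let ?P = "node_poly u I"
  let ?L = "\<lambda>x. block_det (n - k) (Suc n) ?P (w(n := x))"
  let ?R = "\<lambda>x. vandermonde_prod (Suc n) (w(n := x)) * subset_sum u I (Suc k) (Suc n) (w(n := x))"
  have "card I > 0" using prems(8) by simp
  obtain p where p: "degree p < card I + n" "\<And>x. poly p x = ?L x"
    by (rule block_det_last_polynomial[of ?P "n - k" "card I + n" n w])
      (use degree_node_poly[of I u] \<open>card I > 0\<close> prems(1) in auto)
  obtain q where q: "degree q \<le> card I - Suc k + n" "\<And>x. poly q x = ?R x"
    using subset_sum_last_polynomial[OF prems(1,8), where n = n and u = u and w = w] by blast
  \<comment> \<open>The nodes: the other variables, where both sides vanish, and the roots \<open>1/u\<^sub>t\<close>, where the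
    induction hypothesis applies. Their number exceeds the degrees of both sides only because the
    subsets have at least one element.\<close>
  define A where "A = w ` {..<n} \<union> (\<lambda>t. inverse (u t)) ` I"
  have "p = q"
  proof (rule poly_eqI_degree[where A = A])
    have "w ` {..<n} \<inter> (\<lambda>t. inverse (u t)) ` I = {}"
      using prems(3,6) by (force simp: field_simps)
    moreover have "inj_on w {..<n}" "inj_on (\<lambda>t. inverse (u t)) I"
      using prems(2,4) by (auto simp: inj_on_def)
    ultimately have "card A = n + card I"
      unfolding A_def using prems(1) by (subst card_Un_disjoint) (auto simp: card_image)
    then show "card A > degree p" "card A > degree q"
      using p(1) q(1) \<open>card I > 0\<close> prems(8) by linarith+
    fix x assume "x \<in> A"
    then consider a where "a < n" "x = w a" | t where "t \<in> I" "x = inverse (u t)"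
      by (auto simp: A_def)
    then have "?L x = ?R x"
    proof cases
      case 1
      have "?L x = 0"
        by (rule block_det_equal_nodes[of a _ n]) (use 1 in auto)
      moreover have "vandermonde_prod (Suc n) (w(n := x)) = 0"
        using 1 by (auto simp: vandermonde_prod_Suc)
      ultimately show ?thesis by simp
    next
      case 2
      let ?w = "w(n := x)"
      have root: "?w n * u t = 1" using 2 prems(3) by simp
      have P: "?P = [:1, - u t:] * node_poly u (I - {t})"
        unfolding node_poly_def using prems(1) 2(1) by (rule prod.remove)
      have "?L x = (\<Prod>i<n. ?w n - ?w i) * block_det (n - k) n (node_poly u (I - {t})) ?w"
        unfolding P by (rule block_det_last_at_root) (use root in simp_all)
      also have "block_det (n - k) n (node_poly u (I - {t})) ?w
          = block_det (n - k) n (node_poly u (I - {t})) w"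
        by (rule block_det_cong) simp
      also have "\<dots> = vandermonde_prod n w * subset_sum u (I - {t}) k n w"
        using prems \<open>k \<le> n\<close> 2(1)
        by (intro Suc.IH) (auto intro: inj_on_diff simp: inj_on_def card_Diff_singleton)
      also have "\<dots> = vandermonde_prod n ?w * subset_sum u (I - {t}) k n ?w"
        by (simp cong: vandermonde_prod_cong subset_sum_cong)
      also have "subset_sum u (I - {t}) k n ?w = subset_sum u I (Suc k) (Suc n) ?w"
        using prems(1,2) 2(1) root by (rule subset_sum_last_at_root[symmetric])
      finally show ?thesis unfolding vandermonde_prod_Suc by (simp only: mult_ac)
    qed
    then show "poly p x = poly q x" by (simp add: p q)
  qed
  then have "?L (w n) = ?R (w n)" using p(2) q(2) by metis
  then show ?case using \<open>k \<le> n\<close> by (simp add: n' Suc_diff_le)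
qed

section \<open>Factorial Grothendieck polynomials of rectangles\<close>

lemma poly_times_power_window:
  fixes R :: "'b::comm_ring_1 poly"
  assumes "degree R + j < b"
  shows "poly R x * x ^ j = (\<Sum>l\<in>{j..<b}. x ^ l * coeff R (l - j))"
proof -
  have "poly R x = (\<Sum>d<b - j. coeff R d * x ^ d)"
    unfolding poly_altdef
    by (rule sum.mono_neutral_left) (use assms in \<open>auto simp: coeff_eq_0\<close>)
  then have "poly R x * x ^ j = (\<Sum>d<b - j. coeff R d * x ^ (d + j))"
    by (simp add: sum_distrib_right power_add mult.assoc)
  also have "\<dots> = (\<Sum>l\<in>{j..<b}. x ^ l * coeff R (l - j))"
    by (rule sum.reindex_bij_witness[where i = "\<lambda>l. l - j" and j = "\<lambda>d. d + j"]) (use assms in auto)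
  finally show ?thesis .
qed

lemma coeff_0_node_poly: "coeff (node_poly u I) 0 = 1"
  by (simp add: poly_0_coeff_0[symmetric] poly_node_poly)

text \<open>
  After \<open>P\<close> has been split off in the first block, column \<open>j\<close> is \<open>x\<^sup>j\<close> times a polynomial with constant
  term 1 whose degree is at most the number of columns that follow in the same block. Its
  coefficients are therefore those of a unitriangular column operation that does not mix the blocks.
\<close>
lemma det_nested_node_polys:
  fixes u w :: "nat \<Rightarrow> 'b::idom"
  assumes "N \<le> n"
  shows "det (mat n n (\<lambda>(i, j).
      poly (node_poly u {1..(if j < N then m + (N - Suc j) else n - Suc j)}) (w i) * w i ^ j))
    = block_det N n (node_poly u {1..m}) w"
  unfolding block_det_def
proof (rule det_unitriangular_columns)
  \<comment> \<open>The factor of column \<open>j\<close> to be removed; \<open>b\<close> below is the end of the block of that column.\<close>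
  define R where "R j = node_poly u (if j < N then {m<..m + (N - Suc j)} else {1..n - Suc j})" for j
  show "coeff (R j) (j - j) = 1" for j by (simp add: R_def coeff_0_node_poly)
  fix i j assume "j < n"
  define b where "b = (if j < N then N else n)"
  have "degree (R j) \<le> b - Suc j"
    using degree_node_poly[of "{m<..m + (N - Suc j)}" u] degree_node_poly[of "{1..n - Suc j}" u]
    by (simp add: R_def b_def del: add_diff_assoc)
  then have deg: "degree (R j) + j < b" using \<open>j < n\<close> by (auto simp: b_def)
  have head: "poly (node_poly u {1..(if j < N then m + (N - Suc j) else n - Suc j)}) x
      = (if j < N then poly (node_poly u {1..m}) x else 1) * poly (R j) x" for x
  proof (cases "j < N")
    case True
    have "{1..m + (N - Suc j)} = {1..m} \<union> {m<..m + (N - Suc j)}" by auto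
    then have "node_poly u {1..m + (N - Suc j)} = node_poly u {1..m} * node_poly u {m<..m + (N - Suc j)}"
      unfolding node_poly_def by (simp only:) (rule prod.union_disjoint, auto)
    then show ?thesis using True by (simp add: R_def)
  qed (simp add: R_def)
  have "poly (node_poly u {1..(if j < N then m + (N - Suc j) else n - Suc j)}) (w i) * w i ^ j
      = (if j < N then poly (node_poly u {1..m}) (w i) else 1) * (\<Sum>l\<in>{j..<b}. w i ^ l * coeff (R j) (l - j))"
    unfolding head using poly_times_power_window[OF deg, of "w i"] by (simp add: mult.assoc)
  also have "\<dots> = (\<Sum>l\<in>{j..<b}. block_entry N (node_poly u {1..m}) (w i) l * coeff (R j) (l - j))"
    unfolding sum_distrib_left
    by (rule sum.cong) (auto simp: b_def block_entry_def mult.assoc)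
  also have "\<dots> = (\<Sum>l\<in>{j..<n}. block_entry N (node_poly u {1..m}) (w i) l * coeff (R j) (l - j))"
    by (rule sum.mono_neutral_left)
      (use deg assms in \<open>auto simp: b_def coeff_eq_0 split: if_splits\<close>)
  finally show "poly (node_poly u {1..(if j < N then m + (N - Suc j) else n - Suc j)}) (w i) * w i ^ j
      = (\<Sum>l\<in>{j..<n}. block_entry N (node_poly u {1..m}) (w i) l * coeff (R j) (l - j))" .
qed

lemma goplus_eq: "goplus x y = 1 - (1 - x) * (1 - y)"
  by (simp add: goplus_def algebra_simps)

lemma fpow_eq_poly:
  fixes x :: "'b::idom"
  shows "fpow x \<alpha> e = poly (node_poly (\<lambda>t. 1 - \<alpha> t) {1..e}) (1 - x)"
  by (simp add: fpow_def poly_node_poly goplus_eq)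

lemma vandermonde_prod_complement:
  "(\<Prod>(i, j)\<in>{(i, j). 1 \<le> i \<and> i < j \<and> j \<le> n}. z i - z j)
     = vandermonde_prod n (\<lambda>i. 1 - z (i + 1) :: 'b::comm_ring_1)"
proof -
  have "(\<Prod>(i, j)\<in>{(i, j). 1 \<le> i \<and> i < j \<and> j \<le> n}. z i - z j)
      = (\<Prod>(j, i)\<in>(SIGMA j:{..<n}. {..<j}). z (i + 1) - z (j + 1))"
    by (rule prod.reindex_bij_witness[where i = "\<lambda>(j, i). (i + 1, j + 1)" and j = "\<lambda>(i, j). (j - 1, i - 1)"]) auto
  also have "\<dots> = vandermonde_prod n (\<lambda>i. 1 - z (i + 1))"
    unfolding vandermonde_prod_def by (subst prod.Sigma[symmetric]) (auto intro!: prod.cong)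
  finally show ?thesis .
qed

text \<open>
  The identity at points of a field in general position; the denominators in it are then non-zero
  and the interpolation nodes are distinct.
\<close>
lemma factorial_grothendieck_rectangle:
  fixes z \<alpha> :: "nat \<Rightarrow> 'b::field"
  assumes "k \<le> m" "k \<le> n"
    and z: "inj_on z {1..n}" "\<And>i. i \<in> {1..n} \<Longrightarrow> z i \<noteq> 1"
    and \<alpha>: "inj_on \<alpha> {1..m}" "\<And>t. t \<in> {1..m} \<Longrightarrow> \<alpha> t \<noteq> 1"
    and nz: "\<And>i t. i \<in> {1..n} \<Longrightarrow> t \<in> {1..m} \<Longrightarrow> goplus (z i) (\<alpha> t) \<noteq> 0"
  shows "factorial_grothendieck (replicate (n - k) (m - k) @ replicate k 0) z \<alpha> =
    (\<Sum>S\<in>{S. S \<subseteq> {1..m} \<and> card S = k}.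
       ((\<Prod>i\<in>S. (1 - \<alpha> i) ^ (m - k)) * (\<Prod>j\<in>{1..m} - S. \<Prod>i\<in>{1..n}. goplus (z i) (\<alpha> j)))
       / (\<Prod>i\<in>S. \<Prod>j\<in>{1..m} - S. \<alpha> j - \<alpha> i))"
proof -
  define w where "w i = 1 - z (i + 1)" for i
  define u where "u t = 1 - \<alpha> t" for t
  have w_inj: "inj_on w {..<n}"
  proof (rule inj_onI)
    fix i j assume "i \<in> {..<n}" "j \<in> {..<n}" "w i = w j"
    then show "i = j" using inj_onD[OF z(1), of "i + 1" "j + 1"] by (simp add: w_def)
  qed
  let ?lam = "replicate (n - k) (m - k) @ replicate k 0"
  have len: "length ?lam = n" using assms by simp
  have expo: "?lam ! j + n - (j + 1) = (if j < n - k then m + (n - k - Suc j) else n - Suc j)"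
    if "j < n" for j
    using that assms(1,2) by (auto simp: nth_append)
  have entries: "mat n n (\<lambda>(i, j). fpow (z (i + 1)) \<alpha> (?lam ! j + n - (j + 1)) * (1 - z (i + 1)) ^ j)
      = mat n n (\<lambda>(i, j). poly (node_poly u
          {1..(if j < n - k then m + (n - k - Suc j) else n - Suc j)}) (w i) * w i ^ j)"
    by (rule eq_matI) (simp_all add: expo fpow_eq_poly w_def u_def[abs_def] del: One_nat_def)
  have u_inj: "inj_on u {1..m}"
    by (rule inj_onI) (rule inj_onD[OF \<alpha>(1)], simp_all add: u_def)
  have u_nz: "u t \<noteq> 0" if "t \<in> {1..m}" for t
    using \<alpha>(2)[OF that] by (simp add: u_def)
  have w_nz: "w i \<noteq> 0" if "i < n" for i
    using z(2)[of "i + 1"] that by (simp add: w_def)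
  have wu: "w i * u t \<noteq> 1" if "i < n" "t \<in> {1..m}" for i t
    using nz[of "i + 1" t] that by (simp add: goplus_eq w_def u_def)
  have "k \<le> card {1..m}" using assms(1) by simp
  then have expansion: "block_det (n - k) n (node_poly u {1..m}) w
      = vandermonde_prod n w * subset_sum u {1..m} k n w"
    by (intro block_det_eq_subset_sum finite_atLeastAtMost u_inj w_inj \<open>k \<le> n\<close>)
      (erule u_nz, erule w_nz, erule (1) wu)
  have "factorial_grothendieck ?lam z \<alpha>
      = block_det (n - k) n (node_poly u {1..m}) w / vandermonde_prod n w"
    unfolding factorial_grothendieck_def Let_def len entries vandermonde_prod_complement
    by (simp only: det_nested_node_polys[OF diff_le_self] w_def[abs_def])
  also have "\<dots> = subset_sum u {1..m} k n w"
    unfolding expansion using vandermonde_prod_nonzero[OF w_inj] by simp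
  also have "\<dots> = (\<Sum>S\<in>{S. S \<subseteq> {1..m} \<and> card S = k}.
       ((\<Prod>i\<in>S. (1 - \<alpha> i) ^ (m - k)) * (\<Prod>j\<in>{1..m} - S. \<Prod>i\<in>{1..n}. goplus (z i) (\<alpha> j)))
       / (\<Prod>i\<in>S. \<Prod>j\<in>{1..m} - S. \<alpha> j - \<alpha> i))"
  proof -
    have "(\<Prod>i<n. 1 - w i * u j) = (\<Prod>i\<in>{1..n}. goplus (z i) (\<alpha> j))" for j
      by (rule prod.reindex_bij_witness[where i = "\<lambda>i. i - 1" and j = "\<lambda>i. i + 1"])
        (auto simp: w_def u_def goplus_eq)
    then show ?thesis by (simp add: subset_sum_def u_def)
  qed
  finally show ?thesis .
qed

section \<open>Independent indeterminates are in general position\<close>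

lemma single_1_eq_iff:
  "Poly_Mapping.single a (1::'b::zero_neq_one) = Poly_Mapping.single b 1 \<longleftrightarrow> a = b"
proof
  assume "Poly_Mapping.single a (1::'b) = Poly_Mapping.single b 1"
  then have "Poly_Mapping.lookup (Poly_Mapping.single a (1::'b)) b = 1" by simp
  then show "a = b" by (simp add: lookup_single when_def split: if_splits)
qed simp

lemma single_1_eq_1_iff:
  "Poly_Mapping.single a (1::'b::zero_neq_one) = 1 \<longleftrightarrow> a = 0"
  using single_1_eq_iff[of a 0] by simp

lemma single_1_neq_0: "Poly_Mapping.single a (1::'b::zero_neq_one) \<noteq> 0"
proof
  assume "Poly_Mapping.single a (1::'b) = 0"
  then have "Poly_Mapping.lookup (Poly_Mapping.single a (1::'b)) a = 0" by simp
  then show False by simp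
qed

lemma indet_eq_iff: "(indet v :: 'a::idom ratfun) = indet v' \<longleftrightarrow> v = v'"
proof
  assume "(indet v :: 'a ratfun) = indet v'"
  then have "Poly_Mapping.single (Poly_Mapping.single v (1::nat)) (1::'a)
      = Poly_Mapping.single (Poly_Mapping.single v' 1) 1"
    by (simp add: indet_def eq_fract)
  then show "v = v'" by (simp add: single_1_eq_iff del: One_nat_def)
qed simp

lemma indet_neq_1: "(indet v :: 'a::idom ratfun) \<noteq> 1"
proof
  assume "(indet v :: 'a ratfun) = 1"
  then have "Poly_Mapping.single (Poly_Mapping.single v (1::nat)) (1::'a) = Poly_Mapping.single 0 1"
    by (simp add: indet_def One_fract_def eq_fract)
  then show False by (simp add: single_1_eq_1_iff single_1_neq_0 del: One_nat_def)
qed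

text \<open>The monomial \<open>X\<close> occurs in \<open>X + Y\<close> but not in \<open>X Y\<close>.\<close>
lemma goplus_indet_nonzero:
  assumes "v \<noteq> v'"
  shows "goplus (indet v) (indet v' :: 'a::idom ratfun) \<noteq> 0"
proof
  let ?a = "Poly_Mapping.single v (1::nat)" and ?b = "Poly_Mapping.single v' (1::nat)"
  let ?mono = "\<lambda>a. Poly_Mapping.single a (1::'a)"
  assume "goplus (indet v) (indet v' :: 'a ratfun) = 0"
  then have eq: "?mono ?a + ?mono ?b = ?mono (?a + ?b)"
    by (simp add: goplus_def indet_def Zero_fract_def eq_fract mult_single)
  have "?b \<noteq> ?a"
    using assms by (simp add: single_1_eq_iff del: One_nat_def)
  moreover have "?b \<noteq> 0" by (rule single_1_neq_0)
  ultimately have "Poly_Mapping.lookup (?mono ?a + ?mono ?b) ?a = 1"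
    "Poly_Mapping.lookup (?mono (?a + ?b)) ?a = 0"
    by (simp_all add: lookup_add lookup_single_not_eq)
  then show False unfolding eq by simp
qed

theorem theorem4p1:
  fixes m n k :: nat
  assumes "m > 0" and "n > 0" and "k \<le> min m n"
  shows "factorial_grothendieck (replicate (n - k) (m - k) @ replicate k 0) zvar avar =
    (\<Sum>S \<in> {S. S \<subseteq> {1..m} \<and> card S = k}.
       ((\<Prod>i\<in>S. (1 - avar i) ^ (m - k)) *
        (\<Prod>j\<in>{1..m} - S. \<Prod>i\<in>{1..n}. goplus (zvar i) (avar j)))
       / (\<Prod>i\<in>S. \<Prod>j\<in>{1..m} - S. (avar j - (avar i :: 'a::idom ratfun))))"
proof (rule factorial_grothendieck_rectangle)
  show "inj_on zvar {1..n}" "inj_on avar {1..m}"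
    by (auto simp: inj_on_def zvar_def avar_def indet_eq_iff sum_encode_eq)
  show "goplus (zvar i) (avar t :: 'a ratfun) \<noteq> 0" for i t
    by (simp add: zvar_def avar_def goplus_indet_nonzero sum_encode_eq)
qed (use assms in \<open>auto simp: zvar_def avar_def indet_neq_1\<close>)

end
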